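(* Let $n\ge 2$ be an integer, let $x(0)=(x_1(0),\dots,x_n(0))\in\mathbb{R}^n$ be an ordered initial profile, i.e. $x_1(0)\le\dots\le x_n(0)$, and let $\mu\in(0,\tfrac12]$. Put $\Delta x_i(0)=x_{i+1}(0)-x_i(0)$ for $i\in\{1,\dots,n-1\}$. Then $$\max_{1\le i\le n-1}\Delta x_i(0)\;\le\;\varepsilon_{\mathrm{low}}\;\le\;\max_{1\le i\le n-1}\ \sum_{j=0}^{i-1}\mu^{j}\,\Delta x_{i-j}(0),$$ where $\varepsilon_{\mathrm{low}}=\varepsilon_{\mathrm{low}}(x(0),\mu)$ is the infimum of all $\varepsilon>0$ for which there is a communication regime that leads to a consensus from $x(0)$.
   Context: A communication regime for $n$ agents is a sequence $((i_t,j_t))_{t\in\mathbb{N}_0}$ of pairs of distinct agents $i_t,j_t\in\{1,\dots,n\}$. Given $x(0)\in\mathbb{R}^n$, a bound of confidence $\varepsilon>0$, a cautiousness parameter $\mu\in(0,\tfrac12]$ and a communication regime, the Weisbuch-Deffuant (WD) opinion dynamics $(x(t))_{t\in\mathbb{N}_0}$ is defined as follows. At time $t$, with $i=i_t$, $j=j_t$: if $|x_i(t)-x_j(t)|<\varepsilon$, then $x_i(t+1)=(1-\mu)x_i(t)+\mu x_j(t)$ and $x_j(t+1)=\mu x_i(t)+(1-\mu)x_j(t)$; otherwise $x_i(t+1)=x_i(t)$ and $x_j(t+1)=x_j(t)$. All other opinions are unchanged: $x_k(t+1)=x_k(t)$ for $k\ne i,j$. A communication regime leads to a consensus (for given $x(0),\varepsilon,\mu$)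 if there is $c\in\mathbb{R}$ with $\lim_{t\to\infty}x_k(t)=c$ for all $k\in\{1,\dots,n\}$. *)

theory Defs
  imports Complex_Main
begin

text \<open>
  Agents are the numbers \<open>1, \<dots>, n\<close>. A profile in \<open>\<real>\<^sup>n\<close> is a function of type
  \<open>nat \<Rightarrow> real\<close> of which only the values at \<open>1, \<dots>, n\<close> are used.
\<close>

definition communication_regime :: "nat \<Rightarrow> (nat \<Rightarrow> nat \<times> nat) \<Rightarrow> bool" where
  "communication_regime n r \<longleftrightarrow>
     (\<forall>t. fst (r t) \<in> {1..n} \<and> snd (r t) \<in> {1..n} \<and> fst (r t) \<noteq> snd (r t))"

definition wd_step :: "real \<Rightarrow> real \<Rightarrow> nat \<Rightarrow> nat \<Rightarrow> (nat \<Rightarrow> real) \<Rightarrow> (nat \<Rightarrow> real)" where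
  "wd_step \<epsilon> \<mu> i j x =
     (if \<bar>x i - x j\<bar> < \<epsilon>
      then x(i := (1 - \<mu>) * x i + \<mu> * x j, j := \<mu> * x i + (1 - \<mu>) * x j)
      else x)"

primrec wd_process ::
  "real \<Rightarrow> real \<Rightarrow> (nat \<Rightarrow> nat \<times> nat) \<Rightarrow> (nat \<Rightarrow> real) \<Rightarrow> nat \<Rightarrow> (nat \<Rightarrow> real)" where
  "wd_process \<epsilon> \<mu> r x0 0 = x0"
| "wd_process \<epsilon> \<mu> r x0 (Suc t) =
     wd_step \<epsilon> \<mu> (fst (r t)) (snd (r t)) (wd_process \<epsilon> \<mu> r x0 t)"

definition leads_to_consensus ::
  "nat \<Rightarrow> real \<Rightarrow> real \<Rightarrow> (nat \<Rightarrow> real) \<Rightarrow> (nat \<Rightarrow> nat \<times> nat) \<Rightarrow> bool" where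
  "leads_to_consensus n \<epsilon> \<mu> x0 r \<longleftrightarrow>
     (\<exists>c. \<forall>k\<in>{1..n}. (\<lambda>t. wd_process \<epsilon> \<mu> r x0 t k) \<longlonglongrightarrow> c)"

text \<open>
  For \<open>n \<ge> 2\<close> and \<open>0 < \<mu> \<le> 1/2\<close> the set below is nonempty (if \<open>\<epsilon>\<close> exceeds the diameter of the
  initial profile, letting all pairs communicate cyclically gives a consensus) and bounded below
  by \<open>0\<close>, so the infimum in the type \<open>real\<close> is the usual one.
\<close>

definition eps_low :: "nat \<Rightarrow> (nat \<Rightarrow> real) \<Rightarrow> real \<Rightarrow> real" where
  "eps_low n x0 \<mu> =
     Inf {\<epsilon>. \<epsilon> > 0 \<and> (\<exists>r. communication_regime n r \<and> leads_to_consensus n \<epsilon> \<mu> x0 r)}"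

definition opinion_gap :: "(nat \<Rightarrow> real) \<Rightarrow> nat \<Rightarrow> real" where
  "opinion_gap x i = x (i + 1) - x i"

end

theory Submission
  imports Defs
begin

text \<open>
  Lower bound: if \<open>\<epsilon> \<le> \<Delta>x\<^sub>i(0)\<close>, agents \<open>1, \<dots>, i\<close> never interact with the others, so the gap persists.

  Upper bound: put \<open>S\<^sub>i = \<Sum>j<i. \<mu>\<^sup>j \<Delta>x\<^sub>i\<^sub>-\<^sub>j\<close>, so \<open>S\<^sub>i = \<Delta>x\<^sub>i + \<mu> S\<^sub>i\<^sub>-\<^sub>1\<close>. Let the pairs
  \<open>(1,2), (2,3), \<dots>, (n-1,n)\<close> talk in turn. When \<open>(i,i+1)\<close> talk, their distance is exactly \<open>S\<^sub>i\<close>.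
  After the sweep the new values satisfy
  \<open>S'\<^sub>i = (1 - 2\<mu>) S\<^sub>i + \<mu> S\<^sub>i\<^sub>+\<^sub>1 + \<mu> S'\<^sub>i\<^sub>-\<^sub>1\<close> (with \<open>S\<^sub>n = S'\<^sub>0 = 0\<close>), a Gauss-Seidel step for the discrete
  Laplacian. Comparison with constants shows that \<open>max S\<^sub>i\<close> does not increase, so every
  meeting of every further sweep succeeds; comparison with the strictly concave \<open>i (n - i)\<close> shows
  that the \<open>S\<^sub>i\<close>, hence the diameters, decay geometrically.
\<close>

section \<open>The lower bound\<close>

lemma convex_comb_bounds:
  fixes a b \<mu> :: real
  assumes "0 \<le> \<mu>" "\<mu> \<le> 1" "l \<le> a" "a \<le> u" "l \<le> b" "b \<le> u"
  shows "l \<le> (1 - \<mu>) * a + \<mu> * b" "(1 - \<mu>) * a + \<mu> * b \<le> u"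
proof -
  have "(1 - \<mu>) * l + \<mu> * l \<le> (1 - \<mu>) * a + \<mu> * b"
    by (intro add_mono mult_left_mono) (use assms in auto)
  then show "l \<le> (1 - \<mu>) * a + \<mu> * b" by (simp add: algebra_simps)
  have "(1 - \<mu>) * a + \<mu> * b \<le> (1 - \<mu>) * u + \<mu> * u"
    by (intro add_mono mult_left_mono) (use assms in auto)
  then show "(1 - \<mu>) * a + \<mu> * b \<le> u" by (simp add: algebra_simps)
qed

lemma wd_step_bounds:
  fixes \<mu> :: real
  assumes "0 \<le> \<mu>" "\<mu> \<le> 1" "i \<in> A" "j \<in> A" "x ` A \<subseteq> {l..u}"
  shows "wd_step \<epsilon> \<mu> i j x ` A \<subseteq> {l..u}"
proof -
  have b: "l \<le> x k \<and> x k \<le> u" if "k \<in> A" for k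
    using assms(5) that by auto
  have "l \<le> (1 - \<mu>) * x i + \<mu> * x j" "(1 - \<mu>) * x i + \<mu> * x j \<le> u"
    "l \<le> \<mu> * x i + (1 - \<mu>) * x j" "\<mu> * x i + (1 - \<mu>) * x j \<le> u"
    using convex_comb_bounds[of \<mu> l "x i" u "x j"] convex_comb_bounds[of \<mu> l "x j" u "x i"]
      b[OF assms(3)] b[OF assms(4)] assms(1,2) by (auto simp: add.commute)
  then show ?thesis
    using b by (auto simp: wd_step_def)
qed

text \<open>A pair inside one block averages within its own half-line. A pair across the blocks is
  at least \<open>b - a\<close>, hence at least \<open>\<epsilon>\<close>, apart and does not
  interact.\<close>

lemma wd_step_split_invariant:
  fixes \<mu> a b :: real
  assumes "0 \<le> \<mu>" "\<mu> \<le> 1" "\<epsilon> \<le> b - a"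
    and "i \<in> {1..n}" "j \<in> {1..n}"
    and low: "\<And>k. k \<in> {1..m} \<Longrightarrow> x k \<le> a" and high: "\<And>k. k \<in> {m + 1..n} \<Longrightarrow> b \<le> x k"
  shows "(\<forall>k\<in>{1..m}. wd_step \<epsilon> \<mu> i j x k \<le> a) \<and> (\<forall>k\<in>{m + 1..n}. b \<le> wd_step \<epsilon> \<mu> i j x k)"
proof -
  consider "i \<le> m" "j \<le> m" | "i > m" "j > m" | "i \<le> m" "j > m" | "i > m" "j \<le> m"
    by linarith
  then show ?thesis
  proof cases
    case 1
    then have "x i \<le> a" "x j \<le> a" using low assms(4,5) by auto
    then have "(1 - \<mu>) * x i + \<mu> * x j \<le> a" "\<mu> * x i + (1 - \<mu>) * x j \<le> a"
      using convex_comb_bounds(2)[of \<mu> "min (x i) (x j)" "x i" a "x j"]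
        convex_comb_bounds(2)[of \<mu> "min (x i) (x j)" "x j" a "x i"] assms(1,2)
      by (auto simp: add.commute)
    then show ?thesis using 1 low high by (auto simp: wd_step_def)
  next
    case 2
    then have "b \<le> x i" "b \<le> x j" using high assms(4,5) by auto
    then have "b \<le> (1 - \<mu>) * x i + \<mu> * x j" "b \<le> \<mu> * x i + (1 - \<mu>) * x j"
      using convex_comb_bounds(1)[of \<mu> b "x i" "max (x i) (x j)" "x j"]
        convex_comb_bounds(1)[of \<mu> b "x j" "max (x i) (x j)" "x i"] assms(1,2)
      by (auto simp: add.commute)
    then show ?thesis using 2 low high by (auto simp: wd_step_def)
  next
    case 3
    then have "x i \<le> a" "b \<le> x j" using low high assms(4,5) by auto
    then have "wd_step \<epsilon> \<mu> i j x = x" using assms(3) by (auto simp: wd_step_def)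
    then show ?thesis using low high by auto
  next
    case 4
    then have "x j \<le> a" "b \<le> x i" using low high assms(4,5) by auto
    then have "wd_step \<epsilon> \<mu> i j x = x" using assms(3) by (auto simp: wd_step_def)
    then show ?thesis using low high by auto
  qed
qed

lemma consensus_imp_gap_less:
  fixes \<mu> :: real
  assumes "mono_on {1..n} x0" "0 \<le> \<mu>" "\<mu> \<le> 1" "0 < \<epsilon>"
    and reg: "communication_regime n r" and cons: "leads_to_consensus n \<epsilon> \<mu> x0 r"
    and m: "m \<in> {1..n - 1}"
  shows "opinion_gap x0 m < \<epsilon>"
proof (rule ccontr)
  assume "\<not> opinion_gap x0 m < \<epsilon>"
  then have gap: "\<epsilon> \<le> x0 (m + 1) - x0 m" by (simp add: opinion_gap_def)
  \<comment> \<open>The thresholds are the initial opinions on either side of the gap; a common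
    limit would have to lie beyond both.\<close>
  have inv: "(\<forall>k\<in>{1..m}. wd_process \<epsilon> \<mu> r x0 t k \<le> x0 m) \<and>
             (\<forall>k\<in>{m + 1..n}. x0 (m + 1) \<le> wd_process \<epsilon> \<mu> r x0 t k)" for t
  proof (induction t)
    case 0
    then show ?case using m by (auto intro!: mono_onD[OF assms(1)])
  next
    case (Suc t)
    have "fst (r t) \<in> {1..n}" "snd (r t) \<in> {1..n}"
      using reg by (auto simp: communication_regime_def)
    with Suc show ?case
      unfolding wd_process.simps
      by (intro wd_step_split_invariant[OF assms(2,3) gap]) auto
  qed
  obtain c where c: "\<forall>k\<in>{1..n}. (\<lambda>t. wd_process \<epsilon> \<mu> r x0 t k) \<longlonglongrightarrow> c"
    using cons by (auto simp: leads_to_consensus_def)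
  have "c \<le> x0 m"
    by (rule LIMSEQ_le_const2[of "\<lambda>t. wd_process \<epsilon> \<mu> r x0 t m"]) (use c m inv in auto)
  moreover have "x0 (m + 1) \<le> c"
    by (rule LIMSEQ_le_const[of "\<lambda>t. wd_process \<epsilon> \<mu> r x0 t (m + 1)"]) (use c m inv in auto)
  ultimately show False using gap \<open>0 < \<epsilon>\<close> by linarith
qed

section \<open>Sweeping through the chain\<close>

text \<open>The value 0 at index 0 serves as the left boundary value of the sweep
  recurrence.\<close>

primrec discounted_gap :: "real \<Rightarrow> (nat \<Rightarrow> real) \<Rightarrow> nat \<Rightarrow> real" where
  "discounted_gap \<mu> x 0 = 0"
| "discounted_gap \<mu> x (Suc i) = opinion_gap x (Suc i) + \<mu> * discounted_gap \<mu> x i"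

lemma discounted_gap_eq_sum:
  "(\<Sum>j=0..i. \<mu> ^ j * opinion_gap x (Suc i - j)) = discounted_gap \<mu> x (Suc i)"
proof (induction i)
  case (Suc i)
  have "(\<Sum>j=0..Suc i. \<mu> ^ j * opinion_gap x (Suc (Suc i) - j))
      = opinion_gap x (Suc (Suc i)) + \<mu> * (\<Sum>j=0..i. \<mu> ^ j * opinion_gap x (Suc i - j))"
    by (simp add: sum.atLeast0_atMost_Suc_shift sum_distrib_left mult.assoc del: sum.cl_ivl_Suc)
  then show ?case using Suc by simp
qed simp

lemma discounted_gap_nonneg:
  assumes "0 \<le> \<mu>" "\<And>i. i \<in> {1..N} \<Longrightarrow> 0 \<le> opinion_gap x i" "i \<le> N"
  shows "0 \<le> discounted_gap \<mu> x i"
  using assms(3) by (induction i) (use assms(1,2) in auto)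

lemma opinion_gap_le_discounted_gap:
  assumes "0 \<le> \<mu>" "\<And>i. i \<in> {1..N} \<Longrightarrow> 0 \<le> opinion_gap x i" "i \<in> {1..N}"
  shows "opinion_gap x i \<le> discounted_gap \<mu> x i"
proof (cases i)
  case (Suc k)
  then have "0 \<le> discounted_gap \<mu> x k"
    using discounted_gap_nonneg[of \<mu> N x k] assms by auto
  then show ?thesis using Suc assms(1) by simp
qed (use assms in auto)

text \<open>Phases count from 0 and agents from 1, so phase \<open>p\<close> joins
  \<open>p + 1\<close> and \<open>p + 2\<close>.\<close>

definition sweep :: "nat \<Rightarrow> nat \<Rightarrow> nat \<times> nat" where
  "sweep N t = (t mod N + 1, t mod N + 2)"

lemma communication_regime_sweep: "N \<ge> 1 \<Longrightarrow> communication_regime (N + 1) (sweep N)"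
  by (simp add: communication_regime_def sweep_def Suc_le_eq less_SucI)

text \<open>
  The profile after the first \<open>p\<close> meetings of a sweep started at \<open>x\<close>. Agent \<open>0\<close>, which does not
  exist, satisfies the formula because \<open>discounted_gap \<mu> x 0 = 0\<close>.
\<close>

definition swept :: "real \<Rightarrow> (nat \<Rightarrow> real) \<Rightarrow> nat \<Rightarrow> nat \<Rightarrow> real" where
  "swept \<mu> x p = (\<lambda>i. x i - \<mu> * (if i \<le> p + 1 then discounted_gap \<mu> x (i - 1) else 0)
                         + \<mu> * (if i \<le> p then discounted_gap \<mu> x i else 0))"

lemma swept_0: "swept \<mu> x 0 = x"
  by (auto simp: swept_def fun_eq_iff le_Suc_eq)

text \<open>The previous meeting shifted agent \<open>p + 1\<close> by
  \<open>- \<mu> * discounted_gap \<mu> x p\<close>, while \<open>p + 2\<close> has not moved yet;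
  their difference is thus the next discounted gap.\<close>

lemma wd_step_swept:
  assumes "\<bar>discounted_gap \<mu> x (Suc p)\<bar> < \<epsilon>"
  shows "wd_step \<epsilon> \<mu> (p + 1) (p + 2) (swept \<mu> x p) = swept \<mu> x (Suc p)"
proof -
  define z where "z = swept \<mu> x p"
  have z1: "z (p + 1) = x (p + 1) - \<mu> * discounted_gap \<mu> x p"
    and z2: "z (p + 2) = x (p + 2)"
    by (simp_all add: z_def swept_def)
  have d: "z (p + 2) - z (p + 1) = discounted_gap \<mu> x (Suc p)"
    unfolding z1 z2 by (simp add: opinion_gap_def algebra_simps)
  then have "\<bar>z (p + 1) - z (p + 2)\<bar> < \<epsilon>"
    using assms by (simp add: abs_minus_commute)
  then have "wd_step \<epsilon> \<mu> (p + 1) (p + 2) z = z(p + 1 := z (p + 1) + \<mu> * (z (p + 2) - z (p + 1)),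
      p + 2 := z (p + 2) - \<mu> * (z (p + 2) - z (p + 1)))"
    by (simp add: wd_step_def algebra_simps)
  also have "\<dots> = swept \<mu> x (Suc p)"
    unfolding d by (auto simp: fun_eq_iff z1 z2) (auto simp: z_def swept_def le_Suc_eq)
  finally show ?thesis unfolding z_def .
qed

text \<open>The profile at the start of a sweep determines all its meeting distances, so bounding
  them there suffices.\<close>

lemma wd_process_sweep:
  assumes "\<And>i. i \<in> {1..N} \<Longrightarrow> \<bar>discounted_gap \<mu> (wd_process \<epsilon> \<mu> (sweep N) x0 (m * N)) i\<bar> < \<epsilon>"
    and "p \<le> N"
  shows "wd_process \<epsilon> \<mu> (sweep N) x0 (m * N + p)
       = swept \<mu> (wd_process \<epsilon> \<mu> (sweep N) x0 (m * N)) p"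
  using assms(2)
proof (induction p)
  case (Suc p)
  have "sweep N (m * N + p) = (p + 1, p + 2)"
    using Suc.prems by (simp add: sweep_def)
  with Suc show ?case
    using wd_step_swept[OF assms(1)[of "Suc p"]] by simp
qed (simp add: swept_0)

text \<open>Agent \<open>i\<close> meets both neighbours, which gives a second difference of
  discounted gaps; \<open>opinion_gap\<close> plus \<open>\<mu>\<close> times the preceding
  discounted gap is then absorbed into the current one. The last agent has no right neighbour, hence
  the 0.\<close>

lemma opinion_gap_swept:
  assumes "i \<in> {1..N}"
  shows "opinion_gap (swept \<mu> x N) i = (1 - 2 * \<mu>) * discounted_gap \<mu> x i
           + \<mu> * (if i < N then discounted_gap \<mu> x (Suc i) else 0)"
proof -
  obtain k where "i = Suc k" using assms by (cases i) auto
  then show ?thesis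
    using assms by (auto simp: opinion_gap_def swept_def algebra_simps)
qed

text \<open>The coefficients \<open>1 - 2 * \<mu>\<close> and \<open>\<mu>\<close> are nonnegative,
  so a full sweep keeps the profile ordered.\<close>

lemma opinion_gap_swept_nonneg:
  assumes "0 \<le> \<mu>" "\<mu> \<le> 1 / 2" "\<And>i. i \<in> {1..N} \<Longrightarrow> 0 \<le> opinion_gap x i" "i \<in> {1..N}"
  shows "0 \<le> opinion_gap (swept \<mu> x N) i"
  using discounted_gap_nonneg[of \<mu> N x i] discounted_gap_nonneg[of \<mu> N x "Suc i"] assms
  by (auto simp: opinion_gap_swept simp del: discounted_gap.simps intro!: add_nonneg_nonneg)

text \<open>Comparison principle: the update is monotone in the old values and in the new left
  neighbour, so a supersolution dominates by induction from left to right.\<close>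

lemma discounted_gap_swept_le:
  assumes "0 \<le> \<mu>" "\<mu> \<le> 1 / 2"
    and v: "\<And>i. i \<in> {1..N} \<Longrightarrow> discounted_gap \<mu> x i \<le> v i" and "0 \<le> v (Suc N)"
    and "0 \<le> v' 0"
    and super: "\<And>i. i < N \<Longrightarrow>
      (1 - 2 * \<mu>) * v (Suc i) + \<mu> * v (Suc (Suc i)) + \<mu> * v' i \<le> v' (Suc i)"
    and "i \<le> N"
  shows "discounted_gap \<mu> (swept \<mu> x N) i \<le> v' i"
  using \<open>i \<le> N\<close>
proof (induction i)
  case (Suc i)
  \<comment> \<open>At the right end the missing neighbour counts as 0, covered by
    \<open>0 \<le> v (Suc N)\<close>.\<close>
  have next_le: "(if Suc i < N then discounted_gap \<mu> x (Suc (Suc i)) else 0) \<le> v (Suc (Suc i))"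
    using v[of "Suc (Suc i)"] Suc.prems \<open>0 \<le> v (Suc N)\<close> by (auto simp: not_less le_antisym)
  have "discounted_gap \<mu> (swept \<mu> x N) (Suc i)
      = (1 - 2 * \<mu>) * discounted_gap \<mu> x (Suc i)
        + \<mu> * (if Suc i < N then discounted_gap \<mu> x (Suc (Suc i)) else 0)
        + \<mu> * discounted_gap \<mu> (swept \<mu> x N) i"
    using Suc.prems by (subst discounted_gap.simps(2), subst opinion_gap_swept) auto
  also have "\<dots> \<le> (1 - 2 * \<mu>) * v (Suc i) + \<mu> * v (Suc (Suc i)) + \<mu> * v' i"
    by (intro add_mono mult_left_mono next_le v Suc.IH) (use Suc.prems assms(1,2) in auto)
  also have "\<dots> \<le> v' (Suc i)" using super Suc.prems by simp
  finally show ?case .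
qed (use assms in auto)

text \<open>The coefficients \<open>1 - 2 * \<mu>\<close>, \<open>\<mu>\<close>,
  \<open>\<mu>\<close> sum to 1, so a constant is its own barrier.\<close>

lemma discounted_gap_swept_le_const:
  assumes "0 \<le> \<mu>" "\<mu> \<le> 1 / 2" "0 \<le> M"
    and "\<And>i. i \<in> {1..N} \<Longrightarrow> discounted_gap \<mu> x i \<le> M" "i \<le> N"
  shows "discounted_gap \<mu> (swept \<mu> x N) i \<le> M"
  by (rule discounted_gap_swept_le[where v = "\<lambda>_. M"]) (use assms in \<open>auto simp: algebra_simps\<close>)

text \<open>The weight \<open>w N\<close> has second difference -2 and vanishes at 0 and
  \<open>N + 1\<close>. One update lowers it by at least \<open>2 * \<mu>\<close>; as it is at most
  \<open>(N + 1)^2\<close>, this is a loss of at least the factor \<open>\<rho> N\<close>.\<close>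

lemma discounted_gap_swept_contract:
  fixes \<mu> C :: real
  defines "w \<equiv> \<lambda>N i. real i * (real N + 1 - real i)"
  defines "\<rho> \<equiv> \<lambda>N. 1 - 2 * \<mu> / (real N + 1)\<^sup>2"
  assumes "0 \<le> \<mu>" "\<mu> \<le> 1 / 2" "0 \<le> C"
    and "\<And>i. i \<in> {1..N} \<Longrightarrow> discounted_gap \<mu> x i \<le> C * w N i" "i \<le> N"
  shows "discounted_gap \<mu> (swept \<mu> x N) i \<le> \<rho> N * C * w N i"
proof (rule discounted_gap_swept_le[OF assms(3,4), where v = "\<lambda>i. C * w N i"])
  show "0 \<le> C * w N (Suc N)" "0 \<le> \<rho> N * C * w N 0" by (simp_all add: w_def)
  fix i assume "i < N"
  have w0: "0 \<le> w N i" using \<open>i < N\<close> by (simp add: w_def)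
  have "w N (Suc i) \<le> (real N + 1) * (real N + 1)"
    unfolding w_def by (intro mult_mono) (use \<open>i < N\<close> in auto)
  then have "2 * \<mu> * w N (Suc i) \<le> 2 * \<mu> * (real N + 1)\<^sup>2"
    using assms(3) by (intro mult_left_mono) (auto simp: power2_eq_square)
  then have *: "2 * \<mu> / (real N + 1)\<^sup>2 * w N (Suc i) \<le> 2 * \<mu>"
    by (simp add: divide_simps)
  have "\<rho> N * w N i \<le> 1 * w N i"
    using assms(3) w0 by (intro mult_right_mono) (auto simp: \<rho>_def)
  then have "\<mu> * (\<rho> N * w N i) \<le> \<mu> * w N i"
    using assms(3) by (intro mult_left_mono) auto
  then have "(1 - 2 * \<mu>) * w N (Suc i) + \<mu> * w N (Suc (Suc i)) + \<mu> * (\<rho> N * w N i)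
      \<le> (1 - 2 * \<mu>) * w N (Suc i) + \<mu> * w N (Suc (Suc i)) + \<mu> * w N i"
    by simp
  also have "\<dots> = w N (Suc i) - 2 * \<mu>" by (simp add: w_def algebra_simps)
  also have "\<dots> \<le> \<rho> N * w N (Suc i)"
    using * by (simp add: \<rho>_def algebra_simps)
  finally have "C * ((1 - 2 * \<mu>) * w N (Suc i) + \<mu> * w N (Suc (Suc i)) + \<mu> * (\<rho> N * w N i))
      \<le> C * (\<rho> N * w N (Suc i))"
    using \<open>0 \<le> C\<close> by (rule mult_left_mono)
  then show "(1 - 2 * \<mu>) * (C * w N (Suc i)) + \<mu> * (C * w N (Suc (Suc i))) + \<mu> * (\<rho> N * C * w N i)
      \<le> \<rho> N * C * w N (Suc i)"
    by (simp add: algebra_simps)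
qed (use assms in auto)

section \<open>Convergence\<close>

text \<open>One interval holds all agents at all late times, so it controls both the spread and the
  drift of the profile; the limit need not be known beforehand.\<close>

lemma consensusI:
  assumes "n \<ge> 1"
    and sq: "\<And>e. 0 < e \<Longrightarrow> \<exists>T a. \<forall>t\<ge>T. wd_process \<epsilon> \<mu> r x0 t ` {1..n} \<subseteq> {a..a + e}"
  shows "leads_to_consensus n \<epsilon> \<mu> x0 r"
proof -
  let ?X = "wd_process \<epsilon> \<mu> r x0"
  have near: "\<exists>T. \<forall>s\<ge>T. \<forall>t\<ge>T. \<forall>k\<in>{1..n}. \<forall>l\<in>{1..n}. \<bar>?X s k - ?X t l\<bar> < e"
    if "0 < e" for e
  proof -
    obtain T a where T: "\<forall>t\<ge>T. ?X t ` {1..n} \<subseteq> {a..a + e / 2}"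
      using sq[OF half_gt_zero[OF \<open>0 < e\<close>]] by blast
    have "\<bar>?X s k - ?X t l\<bar> < e" if "s \<ge> T" "t \<ge> T" "k \<in> {1..n}" "l \<in> {1..n}" for s t k l
    proof -
      have "?X s k \<in> {a..a + e / 2}" "?X t l \<in> {a..a + e / 2}" using T that by blast+
      then show ?thesis using \<open>0 < e\<close> by auto
    qed
    then show ?thesis by blast
  qed
  have one: "1 \<in> {1..n}" using assms(1) by auto
  have "Cauchy (\<lambda>t. ?X t 1)"
    unfolding Cauchy_def dist_real_def using near one by blast
  then obtain c where c: "(\<lambda>t. ?X t 1) \<longlonglongrightarrow> c"
    using real_Cauchy_convergent convergent_def by blast
  have "(\<lambda>t. ?X t k) \<longlonglongrightarrow> c" if "k \<in> {1..n}" for k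
  proof -
    have "(\<lambda>t. ?X t k - ?X t 1) \<longlonglongrightarrow> 0"
      unfolding LIMSEQ_def dist_real_def using near one that by (metis diff_zero)
    from tendsto_add[OF this c] show ?thesis by simp
  qed
  then show ?thesis unfolding leads_to_consensus_def by blast
qed

text \<open>Lets bounds obtained at the end of a sweep persist through the partial sweeps that
  follow.\<close>

lemma wd_process_bounds:
  fixes \<mu> :: real
  assumes "0 \<le> \<mu>" "\<mu> \<le> 1" "communication_regime n r"
    and "wd_process \<epsilon> \<mu> r x0 T ` {1..n} \<subseteq> {l..u}" "T \<le> t"
  shows "wd_process \<epsilon> \<mu> r x0 t ` {1..n} \<subseteq> {l..u}"
  using \<open>T \<le> t\<close>
proof (induction t rule: dec_induct)
  case (step t)
  then show ?case
    using assms(1-3) by (simp only: wd_process.simps)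
      (intro wd_step_bounds, auto simp: communication_regime_def)
qed (use assms in auto)

lemma profile_bounds_of_gap_bounds:
  assumes "\<And>i. i \<in> {1..N} \<Longrightarrow> 0 \<le> opinion_gap x i"
    and "\<And>i. i \<in> {1..N} \<Longrightarrow> opinion_gap x i \<le> D" and "0 \<le> D"
  shows "x ` {1..N + 1} \<subseteq> {x 1..x 1 + real N * D}"
proof -
  have "x 1 \<le> x (Suc i) \<and> x (Suc i) \<le> x 1 + real i * D" if "i \<le> N" for i
    using that
  proof (induction i)
    case (Suc i)
    then show ?case
      using assms(1)[of "Suc i"] assms(2)[of "Suc i"]
      by (auto simp: opinion_gap_def algebra_simps)
  qed simp
  moreover have "real i * D \<le> real N * D" if "i \<le> N" for i
    using that \<open>0 \<le> D\<close> by (intro mult_right_mono) auto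
  ultimately have "x 1 \<le> x (Suc i) \<and> x (Suc i) \<le> x 1 + real N * D" if "i \<le> N" for i
    using that by fastforce
  moreover have "\<exists>i\<le>N. k = Suc i" if "k \<in> {1..N + 1}" for k
    using that by (cases k) auto
  ultimately show ?thesis by (auto simp: image_subset_iff) fastforce+
qed

lemma sweep_leads_to_consensus:
  fixes \<mu> \<epsilon> :: real
  assumes "N \<ge> 1" "0 < \<mu>" "\<mu> \<le> 1 / 2"
    and "\<And>i. i \<in> {1..N} \<Longrightarrow> 0 \<le> opinion_gap x0 i"
    and "0 \<le> M" "M < \<epsilon>" and "\<And>i. i \<in> {1..N} \<Longrightarrow> discounted_gap \<mu> x0 i \<le> M"
  shows "leads_to_consensus (N + 1) \<epsilon> \<mu> x0 (sweep N)"
proof -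
  define y where "y m = wd_process \<epsilon> \<mu> (sweep N) x0 (m * N)" for m
  define w where "w i = real i * (real N + 1 - real i)" for i :: nat
  define \<rho> where "\<rho> = 1 - 2 * \<mu> / (real N + 1)\<^sup>2"
  have "2 * \<mu> \<le> 1" "1 \<le> (real N + 1)\<^sup>2" using assms(3) by simp_all
  then have "2 * \<mu> \<le> (real N + 1)\<^sup>2" by (rule order_trans)
  then have \<rho>: "0 \<le> \<rho>" "\<rho> < 1"
    using assms(2,3) by (auto simp: \<rho>_def divide_simps)
  \<comment> \<open>Makes \<open>M * w i\<close> a valid barrier for the initial profile.\<close>
  have w1: "1 \<le> w i" if "i \<in> {1..N}" for i
    using mult_mono[of 1 "real i" 1 "real N + 1 - real i"] that by (auto simp: w_def)
  have w2: "w i \<le> (real N + 1)\<^sup>2" if "i \<in> {1..N}" for i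
    unfolding w_def power2_eq_square by (intro mult_mono) (use that in auto)
  \<comment> \<open>Order and the bound \<open>M < \<epsilon>\<close> make every meeting of the next
    sweep succeed; the third bound gives the decay.\<close>
  have inv: "(\<forall>i\<in>{1..N}. 0 \<le> opinion_gap (y m) i \<and> discounted_gap \<mu> (y m) i \<le> M \<and>
               discounted_gap \<mu> (y m) i \<le> \<rho> ^ m * M * w i)" for m
  proof (induction m)
    case 0
    have "discounted_gap \<mu> x0 i \<le> M * w i" if "i \<in> {1..N}" for i
      using assms(7)[OF that] mult_left_mono[OF w1[OF that] \<open>0 \<le> M\<close>] by simp
    then show ?case using assms by (auto simp: y_def)
  next
    case (Suc m)
    have abs: "\<bar>discounted_gap \<mu> (y m) i\<bar> < \<epsilon>" if "i \<in> {1..N}" for i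
      using discounted_gap_nonneg[of \<mu> N "y m" i] Suc that assms(2,6) by force
    have y: "y (Suc m) = swept \<mu> (y m) N"
      using wd_process_sweep[of N \<mu> \<epsilon> x0 m N] abs by (simp add: y_def add.commute)
    have "0 \<le> opinion_gap (y (Suc m)) i \<and> discounted_gap \<mu> (y (Suc m)) i \<le> M \<and>
        discounted_gap \<mu> (y (Suc m)) i \<le> \<rho> ^ Suc m * M * w i" if "i \<in> {1..N}" for i
    proof (intro conjI)
      show "0 \<le> opinion_gap (y (Suc m)) i"
        unfolding y by (rule opinion_gap_swept_nonneg) (use Suc that assms in auto)
      show "discounted_gap \<mu> (y (Suc m)) i \<le> M"
        unfolding y by (rule discounted_gap_swept_le_const) (use Suc that assms in auto)
      have "discounted_gap \<mu> (swept \<mu> (y m) N) i \<le> \<rho> * (\<rho> ^ m * M) * w i"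
        unfolding \<rho>_def w_def
        by (rule discounted_gap_swept_contract)
          (use Suc that assms \<rho> in \<open>auto simp: \<rho>_def[symmetric] w_def\<close>)
      then show "discounted_gap \<mu> (y (Suc m)) i \<le> \<rho> ^ Suc m * M * w i"
        unfolding y by (simp add: mult.assoc)
    qed
    then show ?case by blast
  qed
  \<comment> \<open>The diameter is a sum of \<open>N\<close> gaps, each at most
    \<open>\<rho> ^ m * M * (N + 1)^2\<close>.\<close>
  define K where "K = real N * (M * (real N + 1)\<^sup>2)"
  have box: "y m ` {1..N + 1} \<subseteq> {y m 1..y m 1 + K * \<rho> ^ m}" for m
  proof -
    have "opinion_gap (y m) i \<le> \<rho> ^ m * M * (real N + 1)\<^sup>2" if "i \<in> {1..N}" for i
    proof -
      have "opinion_gap (y m) i \<le> discounted_gap \<mu> (y m) i"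
        by (rule opinion_gap_le_discounted_gap[where N = N]) (use inv that assms in auto)
      also have "\<dots> \<le> \<rho> ^ m * M * w i" using inv that by blast
      also have "\<dots> \<le> \<rho> ^ m * M * (real N + 1)\<^sup>2"
        using w2 that \<rho> \<open>0 \<le> M\<close> by (intro mult_left_mono) auto
      finally show ?thesis .
    qed
    then have "y m ` {1..N + 1} \<subseteq> {y m 1..y m 1 + real N * (\<rho> ^ m * M * (real N + 1)\<^sup>2)}"
      using inv \<rho> \<open>0 \<le> M\<close> by (intro profile_bounds_of_gap_bounds) auto
    then show ?thesis by (simp add: K_def mult_ac)
  qed
  show ?thesis
  proof (rule consensusI)
    fix e :: real assume "0 < e"
    have "(\<lambda>m. K * \<rho> ^ m) \<longlonglongrightarrow> 0"
      using tendsto_mult_left[OF LIMSEQ_power_zero, of \<rho> K] \<rho> by simp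
    then have "eventually (\<lambda>m. K * \<rho> ^ m < e) sequentially"
      using \<open>0 < e\<close> by (rule order_tendstoD)
    then obtain m where "K * \<rho> ^ m < e"
      by (auto simp: eventually_sequentially)
    with box[of m] have "wd_process \<epsilon> \<mu> (sweep N) x0 (m * N) ` {1..N + 1} \<subseteq> {y m 1..y m 1 + e}"
      by (fastforce simp: y_def)
    then have "\<forall>t\<ge>m * N. wd_process \<epsilon> \<mu> (sweep N) x0 t ` {1..N + 1} \<subseteq> {y m 1..y m 1 + e}"
      using wd_process_bounds communication_regime_sweep assms(1-3) by auto
    then show "\<exists>T a. \<forall>t\<ge>T. wd_process \<epsilon> \<mu> (sweep N) x0 t ` {1..N + 1} \<subseteq> {a..a + e}"
      by blast
  qed simp
qed

section \<open>Both bounds for the infimum\<close>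

theorem proposition1:
  fixes n :: nat and x0 :: "nat \<Rightarrow> real" and \<mu> :: real
  assumes "n \<ge> 2"
    and "mono_on {1..n} x0"
    and "0 < \<mu>" and "\<mu> \<le> 1 / 2"
  shows "(MAX i\<in>{1..n - 1}. opinion_gap x0 i) \<le> eps_low n x0 \<mu> \<and>
         eps_low n x0 \<mu> \<le> (MAX i\<in>{1..n - 1}. \<Sum>j=0..i - 1. \<mu> ^ j * opinion_gap x0 (i - j))"
proof -
  define N where "N = n - 1"
  have N: "N \<ge> 1" "n = N + 1" using assms(1) by (auto simp: N_def)
  define E where "E = {\<epsilon>. \<epsilon> > 0 \<and> (\<exists>r. communication_regime n r \<and> leads_to_consensus n \<epsilon> \<mu> x0 r)}"
  define M where "M = (MAX i\<in>{1..N}. \<Sum>j=0..i - 1. \<mu> ^ j * opinion_gap x0 (i - j))"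
  have S: "(\<Sum>j=0..i - 1. \<mu> ^ j * opinion_gap x0 (i - j)) = discounted_gap \<mu> x0 i"
    if "i \<in> {1..N}" for i
    using discounted_gap_eq_sum[where i = "i - 1"] that by (simp del: discounted_gap.simps)
  have SM: "discounted_gap \<mu> x0 i \<le> M" if "i \<in> {1..N}" for i
    unfolding M_def S[OF that, symmetric] by (rule Max_ge) (use that in auto)
  have gap: "0 \<le> opinion_gap x0 i" if "i \<in> {1..N}" for i
    using mono_onD[OF assms(2), of i "i + 1"] that N by (auto simp: opinion_gap_def)
  have "0 \<le> M"
    using SM[of 1] discounted_gap_nonneg[of \<mu> N x0 1] gap assms(3) N by fastforce
  then have mem: "\<epsilon> \<in> E" if "M < \<epsilon>" for \<epsilon>
    using sweep_leads_to_consensus[OF N(1) assms(3,4) gap _ that SM] that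
      communication_regime_sweep[OF N(1)] unfolding E_def N(2) by auto
  have low: "opinion_gap x0 i \<le> \<epsilon>" if "i \<in> {1..N}" "\<epsilon> \<in> E" for i \<epsilon>
    using consensus_imp_gap_less[OF assms(2), of \<mu> \<epsilon> _ i] that assms(3,4)
    by (fastforce simp: E_def N_def)
  have "E \<noteq> {}" using mem[of "M + 1"] by auto
  then have "(MAX i\<in>{1..N}. opinion_gap x0 i) \<le> Inf E"
    using low N by (intro cInf_greatest) auto
  moreover have "Inf E \<le> M"
  \<comment> \<open>Interaction requires distance strictly below \<open>\<epsilon>\<close>, so
    membership in \<open>E\<close> is available only above \<open>M\<close>, and \<open>M\<close> is
    approached from there.\<close>
  proof (rule field_le_epsilon)
    fix e :: real assume "0 < e"
    then show "Inf E \<le> M + e"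
      by (intro cInf_lower mem bdd_belowI[of _ 0]) (auto simp: E_def)
  qed
  ultimately show ?thesis
    unfolding eps_low_def E_def M_def N_def by blast
qed

end
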